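(* Assume Conditions (i), (ii), (iii). Then for almost every $\omega$, $X^\omega$ is a union of finitely many Lipschitz periodic curves: there exist $r^\omega\in\mathbb N$ and Lipschitz continuous functions $\varphi_1^\omega,\dots,\varphi_{r^\omega}^\omega:\mathbb R\to\mathbb R^d$, with $\varphi_i^\omega$ periodic of period $\tau_i^\omega\in\mathbb N$, such that $$X^\omega=\bigcup_{i=1}^{r^\omega}L_i^\omega,\qquad L_i^\omega=\{(s\bmod 1,\varphi_i^\omega(s)):s\in[0,\tau_i^\omega)\},$$ the curves $L_i^\omega$ being pairwise distinct.
   Context: Setting. $(\Omega,\mathcal F,P,(\theta_t)_{t\in\mathbb R})$ is a metric dynamical system: each $\theta_t:\Omega\to\Omega$ is measurable and $P$-preserving, $\theta_0=\mathrm{id}$, $\theta_{t+u}=\theta_t\circ\theta_u$. $S^1=\mathbb R/\mathbb Z$; distances $|s-s'|$ and intervals $[s-\delta,s+\delta]$ on $S^1$ are taken in the lifted real coordinate. A $C^1$ perfect cocycle is a measurable map $\gamma:\mathbb R\times\Omega\times(S^1\times\mathbb R^d)\to S^1\times\mathbb R^d$, $(t,\omega,z)\mapsto \gamma^\omega_z(t)=\gamma^\omega(t)z$, such that for every $\omega$: $\gamma^\omega(0)=\mathrm{id}$; $\gamma^\omega_z(t_1+t_2)=\gamma^{\theta_{t_1}\omega}_{\gamma^\omega_z(t_1)}(t_2)$ for all $z$, $t_1,t_2$; $(t,z)\mapsto\gamma^\omega_z(t)$ is continuous; each $\gamma^\omega(t)$ is a $C^1$ diffeomorphism. Throughout, $\gamma$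 is a $C^1$ perfect cocycle. Condition (i): there are a random compact set $\omega\mapsto Y^\omega\subset\mathbb R^d$ and $t_1>0$ such that for all $s\in S^1$, $y\in Y^\omega$, writing $\gamma^\omega_{(s,y)}(t_1)=(s',y')$, the continuous lift of the $S^1$-coordinate along $t\mapsto\gamma^\omega_{(s,y)}(t)$, $t\in[0,t_1]$, increases by exactly $1$ (i.e. $s'=s+1$ in the lift), and $y'\in Y^{\theta_{t_1}\omega}$; moreover there is a random compact set $X^\omega\subset S^1\times Y^\omega$ with $\gamma^\omega(t)X^\omega=X^{\theta_t\omega}$ for all $t\in\mathbb R$, whose projection onto $S^1$ is all of $S^1$, and whose diameter in the $y$-direction is less than a constant $b^*>0$. Notation. $\hat\theta=\theta_{t_1}$ and $\hat\theta^k$ is its $k$-fold iterate ($k\in\mathbb Z$). $H^\omega(s,y):=\gamma^\omega_{(s,y)}(t_1)=(h(s)\bmod 1,g^\omega(s,y))$ with $h(s)=s+1$; $H^{(n),\omega}:=H^{\hat\theta^{n-1}\omega}\circ\dots\circ H^\omega=(h^{(n)}(s)\bmod1,g^{(n),\omega}(s,y))$. Condition (ii): there are $\delta_1>0$, $L_1>0$ such that for every $(s,y)\in X^\omega$ there is a Lipschitz function $f:S^1\to\mathbb R^d$ with constant $L_1$, $f(s)=y$, and $(s^\#,f(s^\#))\in X^\omega$ for all $s^\#\in[s-\delta_1,s+\delta_1]$. For $\varepsilon>0$, $B(X^\omega,\varepsilon):=\{(s,y'):\exists (s,y)\in X^\omega,\ \|y'-y\|\le\varepsilon\}$. Condition (iii):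 there are $\lambda<1$, $\varepsilon_1>0$, $n_0\in\mathbb N$ such that for a.e. $\omega$, $\|D_yg^{(n_0),\omega}(s,y)\|\le\lambda$ for all $(s,y)\in B(X^\omega,\varepsilon_1)$, and $c:=\operatorname{ess\,sup}_\omega\sup_{(s,y)\in B(X^\omega,\varepsilon_1)}\|\partial_s g^{(n_0),\omega}(s,y)\|<\infty$. *)

theory Defs
  imports "HOL-Probability.Probability"
begin

text \<open>Conventions. A point of the circle S^1 = R/Z is represented by its canonical
  representative in [0,1); a point of S^1 x R^d is a pair (s,y) :: real \<times> 'd with
  s in [0,1). The function frac (x - floor x) is "mod 1". The topology of
  S^1 x R^d is recovered through the embedding temb into complex \<times> 'd.\<close>

definition temb :: "real \<times> 'd \<Rightarrow> complex \<times> 'd" where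
  "temb z = (cis (2 * pi * fst z), snd z)"

abbreviation circ_space :: "(real \<times> 'd) set" where
  "circ_space \<equiv> {0..<1} \<times> UNIV"

definition metric_dynamical_system :: "'w measure \<Rightarrow> (real \<Rightarrow> 'w \<Rightarrow> 'w) \<Rightarrow> bool" where
  "metric_dynamical_system P \<theta> \<longleftrightarrow>
     prob_space P \<and>
     (\<forall>t. \<theta> t \<in> P \<rightarrow>\<^sub>M P \<and> distr P P (\<theta> t) = P) \<and>
     (\<forall>\<omega>\<in>space P. \<theta> 0 \<omega> = \<omega>) \<and>
     (\<forall>t u. \<forall>\<omega>\<in>space P. \<theta> (t + u) \<omega> = \<theta> t (\<theta> u \<omega>))"

text \<open>A map F of S^1 x R^d (given on representatives) is C^1: it has a lift
  R x R^d \<rightarrow> R x R^d which is continuously differentiable.\<close>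
definition circ_C1 :: "(real \<times> 'd::euclidean_space \<Rightarrow> real \<times> 'd) \<Rightarrow> bool" where
  "circ_C1 F \<longleftrightarrow>
     (\<exists>F' Fd. (\<forall>s y. frac (fst (F' (s, y))) = frac (fst (F (frac s, y))) \<and>
                      snd (F' (s, y)) = snd (F (frac s, y))) \<and>
              (\<forall>z. (F' has_derivative blinfun_apply (Fd z)) (at z)) \<and>
              continuous_on UNIV Fd)"

definition circ_C1_diffeo :: "(real \<times> 'd::euclidean_space \<Rightarrow> real \<times> 'd) \<Rightarrow> bool" where
  "circ_C1_diffeo F \<longleftrightarrow>
     circ_C1 F \<and>
     (\<exists>G. (\<forall>z\<in>circ_space. F z \<in> circ_space \<and> G z \<in> circ_space \<and> G (F z) = z \<and> F (G z) = z) \<and>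
          circ_C1 (\<lambda>(s, y). G (frac s, y)))"

definition perfect_C1_cocycle ::
  "'w measure \<Rightarrow> (real \<Rightarrow> 'w \<Rightarrow> 'w) \<Rightarrow> ('w \<Rightarrow> real \<Rightarrow> real \<times> 'd::euclidean_space \<Rightarrow> real \<times> 'd) \<Rightarrow> bool" where
  "perfect_C1_cocycle P \<theta> \<gamma> \<longleftrightarrow>
     (\<lambda>(t, \<omega>, z). \<gamma> \<omega> t z) \<in> (borel \<Otimes>\<^sub>M P \<Otimes>\<^sub>M borel) \<rightarrow>\<^sub>M borel \<and>
     (\<forall>\<omega>\<in>space P.
        (\<forall>t s y. \<gamma> \<omega> t (s, y) = \<gamma> \<omega> t (frac s, y) \<and> fst (\<gamma> \<omega> t (s, y)) \<in> {0..<1}) \<and>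
        (\<forall>s y. \<gamma> \<omega> 0 (s, y) = (frac s, y)) \<and>
        (\<forall>t1 t2 z. \<gamma> \<omega> (t1 + t2) z = \<gamma> (\<theta> t1 \<omega>) t2 (\<gamma> \<omega> t1 z)) \<and>
        continuous_on UNIV (\<lambda>(t, s, y). temb (\<gamma> \<omega> t (s, y))) \<and>
        (\<forall>t. circ_C1_diffeo (\<gamma> \<omega> t)))"

definition random_compact_set :: "'w measure \<Rightarrow> ('w \<Rightarrow> 'd::euclidean_space set) \<Rightarrow> bool" where
  "random_compact_set P K \<longleftrightarrow>
     (\<forall>\<omega>\<in>space P. compact (K \<omega>)) \<and>
     (\<forall>x. (\<lambda>\<omega>. infdist x (K \<omega>)) \<in> borel_measurable P)"

definition random_compact_set_circ :: "'w measure \<Rightarrow> ('w \<Rightarrow> (real \<times> 'd::euclidean_space) set) \<Rightarrow> bool" where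
  "random_compact_set_circ P K \<longleftrightarrow>
     (\<forall>\<omega>\<in>space P. K \<omega> \<subseteq> circ_space \<and> compact (temb ` K \<omega>)) \<and>
     (\<forall>z\<in>circ_space. (\<lambda>\<omega>. infdist (temb z) (temb ` K \<omega>)) \<in> borel_measurable P)"

fun Hiter :: "('w \<Rightarrow> real \<Rightarrow> real \<times> 'd \<Rightarrow> real \<times> 'd) \<Rightarrow> (real \<Rightarrow> 'w \<Rightarrow> 'w) \<Rightarrow> real \<Rightarrow> nat \<Rightarrow> 'w \<Rightarrow> real \<times> 'd \<Rightarrow> real \<times> 'd" where
  "Hiter \<gamma> \<theta> t1 0 \<omega> z = z"
| "Hiter \<gamma> \<theta> t1 (Suc n) \<omega> z = \<gamma> ((\<theta> t1 ^^ n) \<omega>) t1 (Hiter \<gamma> \<theta> t1 n \<omega> z)"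

definition giter :: "('w \<Rightarrow> real \<Rightarrow> real \<times> 'd \<Rightarrow> real \<times> 'd) \<Rightarrow> (real \<Rightarrow> 'w \<Rightarrow> 'w) \<Rightarrow> real \<Rightarrow> nat \<Rightarrow> 'w \<Rightarrow> real \<times> 'd \<Rightarrow> 'd" where
  "giter \<gamma> \<theta> t1 n \<omega> z = snd (Hiter \<gamma> \<theta> t1 n \<omega> z)"

definition Bnbhd :: "(real \<times> 'd::real_normed_vector) set \<Rightarrow> real \<Rightarrow> (real \<times> 'd) set" where
  "Bnbhd A \<epsilon> = {(s, y'). \<exists>y. (s, y) \<in> A \<and> norm (y' - y) \<le> \<epsilon>}"

definition condition_i ::
  "'w measure \<Rightarrow> (real \<Rightarrow> 'w \<Rightarrow> 'w) \<Rightarrow> ('w \<Rightarrow> real \<Rightarrow> real \<times> 'd::euclidean_space \<Rightarrow> real \<times> 'd)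
    \<Rightarrow> real \<Rightarrow> ('w \<Rightarrow> 'd set) \<Rightarrow> ('w \<Rightarrow> (real \<times> 'd) set) \<Rightarrow> real \<Rightarrow> bool" where
  "condition_i P \<theta> \<gamma> t1 Y X bstar \<longleftrightarrow>
     random_compact_set P Y \<and> t1 > 0 \<and>
     (\<forall>\<omega>\<in>space P. \<forall>s\<in>{0..<1}. \<forall>y\<in>Y \<omega>.
        (\<exists>lft. continuous_on {0..t1} lft \<and>
             (\<forall>t\<in>{0..t1}. frac (lft t) = fst (\<gamma> \<omega> t (s, y))) \<and>
             lft t1 = lft 0 + 1) \<and>
        snd (\<gamma> \<omega> t1 (s, y)) \<in> Y (\<theta> t1 \<omega>)) \<and>
     random_compact_set_circ P X \<and>
     (\<forall>\<omega>\<in>space P. X \<omega> \<subseteq> {0..<1} \<times> Y \<omega>) \<and>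
     (\<forall>\<omega>\<in>space P. \<forall>t. \<gamma> \<omega> t ` X \<omega> = X (\<theta> t \<omega>)) \<and>
     (\<forall>\<omega>\<in>space P. fst ` X \<omega> = {0..<1}) \<and>
     bstar > 0 \<and>
     (\<forall>\<omega>\<in>space P. \<forall>s y y'. (s, y) \<in> X \<omega> \<longrightarrow> (s, y') \<in> X \<omega> \<longrightarrow> norm (y - y') < bstar)"

definition condition_ii :: "'w measure \<Rightarrow> ('w \<Rightarrow> (real \<times> 'd::euclidean_space) set) \<Rightarrow> bool" where
  "condition_ii P X \<longleftrightarrow>
     (\<exists>\<delta>1 L1. \<delta>1 > 0 \<and> L1 > 0 \<and>
        (\<forall>\<omega>\<in>space P. \<forall>s y. (s, y) \<in> X \<omega> \<longrightarrow>
           (\<exists>f :: real \<Rightarrow> 'd. L1-lipschitz_on UNIV f \<and> (\<forall>x. f (x + 1) = f x) \<and> f s = y \<and>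
                (\<forall>s'\<in>{s - \<delta>1..s + \<delta>1}. (frac s', f s') \<in> X \<omega>))))"

definition condition_iii ::
  "'w measure \<Rightarrow> (real \<Rightarrow> 'w \<Rightarrow> 'w) \<Rightarrow> ('w \<Rightarrow> real \<Rightarrow> real \<times> 'd::euclidean_space \<Rightarrow> real \<times> 'd)
    \<Rightarrow> real \<Rightarrow> ('w \<Rightarrow> (real \<times> 'd) set) \<Rightarrow> bool" where
  "condition_iii P \<theta> \<gamma> t1 X \<longleftrightarrow>
     (\<exists>lam \<epsilon>1 (n0::nat). lam < 1 \<and> \<epsilon>1 > 0 \<and>
        (AE \<omega> in P. \<forall>s y. (s, y) \<in> Bnbhd (X \<omega>) \<epsilon>1 \<longrightarrow>
            (\<exists>D. ((\<lambda>y'. giter \<gamma> \<theta> t1 n0 \<omega> (s, y')) has_derivative D) (at y) \<and> onorm D \<le> lam)) \<and>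
        (\<exists>C. AE \<omega> in P. \<forall>s y. (s, y) \<in> Bnbhd (X \<omega>) \<epsilon>1 \<longrightarrow>
            (\<exists>v. ((\<lambda>s'. giter \<gamma> \<theta> t1 n0 \<omega> (frac s', y)) has_vector_derivative v) (at s) \<and> norm v \<le> C)))"

definition periodic_curve :: "(real \<Rightarrow> 'd) \<Rightarrow> nat \<Rightarrow> (real \<times> 'd) set" where
  "periodic_curve \<phi> \<tau> = {(frac s, \<phi> s) | s. s \<in> {0..<real \<tau>}}"

end

theory Submission
  imports Defs
begin

text \<open>
  Over the time \<open>n0 * t1\<close> the cocycle maps each fibre \<open>X \<omega> `` {s}\<close> bijectively onto
  \<open>X (\<theta> (n0 * t1) \<omega>) `` {s}\<close> and contracts pairs of points at distance at most \<open>\<epsilon>\<close>. Pulling a fibre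
  back along the orbit therefore bounds its cardinality by the number of \<open>\<epsilon>\<close>-separated points in a
  ball of radius \<open>bstar\<close>. A pair of distinct points closer than \<open>\<epsilon>\<close> would come arbitrarily close in
  the future; as \<open>\<theta>\<close> preserves \<open>P\<close> and finite fibres have positive minimal distance, this has
  probability zero for each fixed \<open>s\<close>, hence for all rational \<open>s\<close> at once, and by the local Lipschitz
  curves for all \<open>s\<close>. In a set with \<open>\<epsilon>\<close>-separated fibres the local curves continue uniquely to curves
  over the whole line, and these are periodic because the fibre over \<open>0\<close> is finite.
\<close>

section \<open>Packing and finiteness under backward contraction\<close>

text \<open>Finitely many balls of radius \<open>e / 2\<close> cover \<open>cball 0 b\<close>, and
  none of them holds two points at distance above \<open>e\<close>. Translating a point of
  \<open>S\<close> to the origin puts \<open>S\<close> into that ball, so one \<open>N\<close>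
  serves all such sets.\<close>

lemma card_separated_bound:
  fixes b e :: real
  assumes "0 < e"
  obtains N where
    "\<And>S :: 'a::euclidean_space set. \<lbrakk>\<And>x y. x \<in> S \<Longrightarrow> y \<in> S \<Longrightarrow> dist x y \<le> b;
        \<And>x y. x \<in> S \<Longrightarrow> y \<in> S \<Longrightarrow> x \<noteq> y \<Longrightarrow> e < dist x y\<rbrakk> \<Longrightarrow> card S \<le> N"
proof -
  have "compact (cball (0::'a) b)" by simp
  then obtain K where K: "finite K" "cball (0::'a) b \<subseteq> (\<Union>x\<in>K. ball x (e / 2))"
    using assms unfolding compact_eq_totally_bounded by (meson half_gt_zero)
  show thesis
  proof (rule that[of "card K"])
    fix S :: "'a set"
    assume diam: "\<And>x y. x \<in> S \<Longrightarrow> y \<in> S \<Longrightarrow> dist x y \<le> b"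
      and sep: "\<And>x y. x \<in> S \<Longrightarrow> y \<in> S \<Longrightarrow> x \<noteq> y \<Longrightarrow> e < dist x y"
    show "card S \<le> card K"
    proof (cases "S = {}")
      case False
      then obtain p where p: "p \<in> S" by blast
      have "\<exists>k\<in>K. dist k (x - p) < e / 2" if "x \<in> S" for x
      proof -
        have "x - p \<in> cball 0 b"
          using diam[OF that p] by (simp add: dist_norm norm_minus_commute)
        then show ?thesis using K(2) by fastforce
      qed
      then obtain c where c: "\<And>x. x \<in> S \<Longrightarrow> c x \<in> K \<and> dist (c x) (x - p) < e / 2"
        by metis
      have "inj_on c S"
      proof (rule inj_onI, rule ccontr)
        fix x y assume xy: "x \<in> S" "y \<in> S" "c x = c y" "x \<noteq> y"
        have "dist (x - p) (y - p) < e"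
          using c[OF xy(1)] c[OF xy(2)] xy(3) by (metis dist_triangle_half_r)
        then show False using sep[OF xy(1,2,4)] by (simp add: dist_norm norm_minus_commute)
      qed
      then show ?thesis
        using c K(1) by (intro card_inj_on_le) auto
    qed simp
  qed
qed

text \<open>At most \<open>N\<close> points fit into a set of diameter \<open>b\<close> with mutual distances above \<open>\<epsilon>\<close>. If \<open>F 0\<close>
  had more than \<open>N\<close> points, their preimages in \<open>F n\<close> would contain, for every \<open>n\<close>, two points within
  distance \<open>\<epsilon>\<close>, and the images of these in \<open>F 0\<close> are within \<open>\<lambda>\<^sup>n * \<epsilon>\<close>.\<close>
lemma finite_of_backward_contraction:
  fixes F :: "nat \<Rightarrow> 'a::euclidean_space set" and b \<epsilon> lam :: real
  assumes onto: "\<And>n. g n ` F (Suc n) = F n"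
    and diam: "\<And>n x y. x \<in> F n \<Longrightarrow> y \<in> F n \<Longrightarrow> dist x y \<le> b"
    and contr: "\<And>n x y. x \<in> F (Suc n) \<Longrightarrow> y \<in> F (Suc n) \<Longrightarrow> dist x y \<le> \<epsilon> \<Longrightarrow>
                  dist (g n x) (g n y) \<le> lam * dist x y"
    and lam: "0 \<le> lam" "lam < 1" and "0 < \<epsilon>"
  shows "finite (F 0)"
proof (rule ccontr)
  assume inf: "infinite (F 0)"
  obtain N where N: "\<And>S :: 'a set. \<lbrakk>\<And>x y. x \<in> S \<Longrightarrow> y \<in> S \<Longrightarrow> dist x y \<le> b;
        \<And>x y. x \<in> S \<Longrightarrow> y \<in> S \<Longrightarrow> x \<noteq> y \<Longrightarrow> \<epsilon> < dist x y\<rbrakk> \<Longrightarrow> card S \<le> N"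
    using card_separated_bound[OF \<open>0 < \<epsilon>\<close>] by metis
  obtain S where S: "S \<subseteq> F 0" "finite S" "card S = Suc N"
    using infinite_arbitrarily_large[OF inf] by blast
  \<comment> \<open>The gaps of a finite set have a positive lower bound \<open>d\<close>. It is
    fixed before the depth \<open>n\<close>, which is then taken so large that
    \<open>lam ^ n * \<epsilon>\<close> lies below it.\<close>
  have "uniform_discrete S"
    using S(2) uniform_discrete_finite_iff by blast
  then obtain d where d: "0 < d" "\<And>x y. x \<in> S \<Longrightarrow> y \<in> S \<Longrightarrow> dist x y < d \<Longrightarrow> x = y"
    unfolding uniform_discrete_def by blast
  \<comment> \<open>\<open>G\<close> is the composite
    \<open>g 0 \<circ> ... \<circ> g (n - 1)\<close>. A pair within \<epsilon> stays within
    \<epsilon> at every stage because \<open>lam < 1\<close>, so the one-step bound can be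
    iterated.\<close>
  have comp: "\<exists>G. G ` F n = F 0 \<and> (\<forall>x\<in>F n. \<forall>y\<in>F n. dist x y \<le> \<epsilon> \<longrightarrow>
      dist (G x) (G y) \<le> lam ^ n * dist x y)" for n
  proof (induction n)
    case 0
    show ?case by (rule exI[of _ id]) simp
  next
    case (Suc n)
    then obtain G where G: "G ` F n = F 0"
      "\<And>x y. x \<in> F n \<Longrightarrow> y \<in> F n \<Longrightarrow> dist x y \<le> \<epsilon> \<Longrightarrow> dist (G x) (G y) \<le> lam ^ n * dist x y"
      by blast
    have "dist (G (g n x)) (G (g n y)) \<le> lam ^ Suc n * dist x y"
      if xy: "x \<in> F (Suc n)" "y \<in> F (Suc n)" "dist x y \<le> \<epsilon>" for x y
    proof -
      have gc: "dist (g n x) (g n y) \<le> lam * dist x y" using contr xy by blast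
      also have "\<dots> \<le> 1 * dist x y" using lam by (intro mult_right_mono) auto
      finally have "dist (G (g n x)) (G (g n y)) \<le> lam ^ n * dist (g n x) (g n y)"
        using xy onto[of n] by (intro G(2)) auto
      also have "\<dots> \<le> lam ^ n * (lam * dist x y)"
        using gc lam by (intro mult_left_mono) auto
      finally show ?thesis by (simp add: mult_ac)
    qed
    moreover have "(G \<circ> g n) ` F (Suc n) = F 0"
      using G(1) onto[of n] by (metis image_comp)
    ultimately show ?case by (intro exI[of _ "G \<circ> g n"]) simp
  qed
  have "(\<lambda>n. lam ^ n * \<epsilon>) \<longlonglongrightarrow> 0 * \<epsilon>"
    using lam by (intro tendsto_intros LIMSEQ_realpow_zero) auto
  then obtain n where n: "lam ^ n * \<epsilon> < d"
    using order_tendstoD(2)[of _ 0 sequentially d] d(1)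
    by (auto simp: eventually_sequentially)
  obtain G where G: "G ` F n = F 0"
      "\<And>x y. x \<in> F n \<Longrightarrow> y \<in> F n \<Longrightarrow> dist x y \<le> \<epsilon> \<Longrightarrow> dist (G x) (G y) \<le> lam ^ n * dist x y"
    using comp by blast
  define R where "R = inv_into (F n) G ` S"
  have R_sub: "R \<subseteq> F n" and GR: "\<And>x. x \<in> R \<Longrightarrow> G x \<in> S"
    using S(1) G(1) by (auto simp: R_def inv_into_into f_inv_into_f)
  have cardR: "card R = card S"
    unfolding R_def using S(1) G(1) by (intro card_image inj_on_inv_into) simp
  have "card R \<le> N"
  proof (rule N)
    show "dist x y \<le> b" if "x \<in> R" "y \<in> R" for x y
      using that R_sub diam by blast
    show "\<epsilon> < dist x y" if xy: "x \<in> R" "y \<in> R" "x \<noteq> y" for x y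
    proof (rule ccontr)
      assume "\<not> \<epsilon> < dist x y"
      then have close: "dist x y \<le> \<epsilon>" by simp
      then have "dist (G x) (G y) \<le> lam ^ n * dist x y"
        using xy R_sub by (intro G(2)) auto
      also have "\<dots> \<le> lam ^ n * \<epsilon>" using close lam by (intro mult_left_mono) auto
      finally have "dist (G x) (G y) < d" using n by simp
      then have eq: "G x = G y" using d(2) GR xy by blast
      obtain u v where uv: "u \<in> S" "v \<in> S" "x = inv_into (F n) G u" "y = inv_into (F n) G v"
        using xy by (auto simp: R_def)
      then have "G x = u" "G y = v" using S(1) G(1) by (auto simp: f_inv_into_f)
      then show False using eq uv xy by simp
    qed
  qed
  then show False using S(3) cardR by simp
qed

section \<open>Null events from recurrence into shrinking sets\<close>

text \<open>Almost every point of \<open>A 0\<close> is carried into \<open>A k\<close> by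
  \<open>T k\<close>, so invariance bounds the measure of \<open>A 0\<close> by that of
  \<open>A k\<close>. By continuity from above these measures tend to that of the intersection,
  which is null by \<open>escape\<close>.\<close>

lemma AE_notin_of_shrinking_recurrence:
  assumes "prob_space M"
    and A: "\<And>k::nat. A k \<in> sets M" "decseq A"
    and T: "\<And>k. T k \<in> M \<rightarrow>\<^sub>M M" "\<And>k. distr M M (T k) = M"
    and step: "AE x in M. \<forall>k. x \<in> A 0 \<longrightarrow> T k x \<in> A k"
    and escape: "AE x in M. \<exists>k. x \<notin> A k"
  shows "AE x in M. x \<notin> A 0"
proof -
  interpret prob_space M by fact
  have le: "emeasure M (A 0) \<le> emeasure M (A k)" for k
  proof -
    have "emeasure M (A 0) \<le> emeasure M (T k -` A k \<inter> space M)"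
    proof (rule emeasure_mono_AE)
      show "AE x in M. x \<in> A 0 \<longrightarrow> x \<in> T k -` A k \<inter> space M"
        using step by (rule AE_mp) auto
      show "T k -` A k \<inter> space M \<in> sets M" using T(1) A(1) by measurable
    qed
    also have "\<dots> = emeasure M (A k)"
      using emeasure_distr[OF T(1) A(1), of k k] T(2)[of k] by simp
    finally show ?thesis .
  qed
  have "(\<lambda>k. emeasure M (A k)) \<longlonglongrightarrow> emeasure M (\<Inter>k. A k)"
    using A by (intro Lim_emeasure_decseq) (auto simp: emeasure_eq_measure)
  then have "emeasure M (A 0) \<le> emeasure M (\<Inter>k. A k)"
    by (rule LIMSEQ_le_const) (use le in auto)
  also have "\<dots> = 0"
  proof -
    have "AE x in M. x \<notin> (\<Inter>k. A k)" using escape by (rule AE_mp) auto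
    moreover have "(\<Inter>k. A k) \<in> sets M" using A(1) by auto
    ultimately show ?thesis using AE_iff_measurable[of "\<Inter>k. A k" M "\<lambda>x. x \<notin> (\<Inter>k. A k)"]
      by (auto dest: sets.sets_into_space)
  qed
  finally have "A 0 \<in> null_sets M" using A(1) by (auto simp: null_sets_def)
  then show ?thesis by (rule AE_not_in)
qed

section \<open>Continuation of curves in sets with separated fibres\<close>

text \<open>The distance between the two graphs is continuous on a connected set and is either
  \<open>0\<close> or at least \<epsilon>. Vanishing at \<open>p\<close> but not at
  \<open>q\<close>, it would have to take the value \<open>\<epsilon> / 2\<close>.\<close>

lemma graphs_in_separated_fibres_agree:
  fixes f g :: "real \<Rightarrow> 'a::metric_space"
  assumes cont: "continuous_on I f" "continuous_on I g" and "connected I"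
    and fg: "\<And>s. s \<in> I \<Longrightarrow> (frac s, f s) \<in> K" "\<And>s. s \<in> I \<Longrightarrow> (frac s, g s) \<in> K"
    and sep: "\<And>s y y'. (s, y) \<in> K \<Longrightarrow> (s, y') \<in> K \<Longrightarrow> y \<noteq> y' \<Longrightarrow> \<epsilon> \<le> dist y y'"
    and "0 < \<epsilon>" and p: "p \<in> I" "f p = g p" and q: "q \<in> I"
  shows "f q = g q"
proof (rule ccontr)
  assume ne: "f q \<noteq> g q"
  define h where "h s = dist (f s) (g s)" for s
  have "connected (h ` I)"
    unfolding h_def using cont \<open>connected I\<close>
    by (intro connected_continuous_image continuous_on_dist)
  moreover have "0 \<in> h ` I" using p by (force simp: h_def)
  moreover have "h q \<in> h ` I" "\<epsilon> \<le> h q"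
    using q sep[OF fg(1)[OF q] fg(2)[OF q] ne] by (auto simp: h_def)
  moreover have "0 \<le> \<epsilon> / 2" "\<epsilon> / 2 \<le> h q"
    using \<open>0 < \<epsilon>\<close> \<open>\<epsilon> \<le> h q\<close> by linarith+
  ultimately have "\<epsilon> / 2 \<in> h ` I"
    by (meson connectedD_interval)
  then obtain s where s: "s \<in> I" "\<epsilon> / 2 = dist (f s) (g s)" by (auto simp: h_def)
  then have "f s \<noteq> g s" using \<open>0 < \<epsilon>\<close> by auto
  then have "\<epsilon> \<le> \<epsilon> / 2" unfolding s(2) by (intro sep[OF fg(1)[OF s(1)] fg(2)[OF s(1)]])
  then show False using \<open>0 < \<epsilon>\<close> by simp
qed

text \<open>Local curves are glued at both ends of an interval around \<open>s0\<close>, which grows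
  by \<delta> on either side per step. Lipschitz bounds on adjacent intervals combine without loss
  in \<open>L\<close>, and separation makes the curves on the growing intervals consistent.\<close>

lemma ex_lipschitz_section:
  fixes K :: "(real \<times> 'a::metric_space) set"
  assumes extend: "\<And>s y. (frac s, y) \<in> K \<Longrightarrow> \<exists>f. L-lipschitz_on {s - \<delta>..s + \<delta>} f \<and> f s = y \<and>
                   (\<forall>s'\<in>{s - \<delta>..s + \<delta>}. (frac s', f s') \<in> K)"
    and sep: "\<And>s y y'. (s, y) \<in> K \<Longrightarrow> (s, y') \<in> K \<Longrightarrow> y \<noteq> y' \<Longrightarrow> \<epsilon> \<le> dist y y'"
    and pos: "0 < \<delta>" "0 < \<epsilon>" and K: "(frac s0, y0) \<in> K"
  obtains \<phi> where "L-lipschitz_on UNIV \<phi>" "\<phi> s0 = y0" "\<And>s. (frac s, \<phi> s) \<in> K"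
proof -
  define I where "I n = {s0 - real n * \<delta>..s0 + real n * \<delta>}" for n
  have s0: "s0 \<in> I n" for n using pos by (simp add: I_def)
  have "\<exists>g. L-lipschitz_on (I n) g \<and> g s0 = y0 \<and> (\<forall>s\<in>I n. (frac s, g s) \<in> K)" for n
  proof (induction n)
    case 0
    have "0 \<le> L" using extend[OF K] lipschitz_on_nonneg by blast
    then show ?case using K by (intro exI[of _ "\<lambda>_. y0"]) (auto simp: I_def)
  next
    case (Suc n)
    then obtain g where g: "L-lipschitz_on (I n) g" "g s0 = y0" "\<And>s. s \<in> I n \<Longrightarrow> (frac s, g s) \<in> K"
      by blast
    define a where "a = s0 - real n * \<delta>"
    define b where "b = s0 + real n * \<delta>"
    have In: "I n = {a..b}" and ISuc: "I (Suc n) = {a - \<delta>..b + \<delta>}"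
      and ab: "a \<le> s0" "s0 \<le> b"
      using pos by (auto simp: I_def a_def b_def algebra_simps)
    obtain f1 where f1: "L-lipschitz_on {a - \<delta>..a + \<delta>} f1" "f1 a = g a"
        "\<And>s. s \<in> {a - \<delta>..a + \<delta>} \<Longrightarrow> (frac s, f1 s) \<in> K"
      using extend[OF g(3)[of a]] In ab by auto
    obtain f2 where f2: "L-lipschitz_on {b - \<delta>..b + \<delta>} f2" "f2 b = g b"
        "\<And>s. s \<in> {b - \<delta>..b + \<delta>} \<Longrightarrow> (frac s, f2 s) \<in> K"
      using extend[OF g(3)[of b]] In ab by auto
    define h where "h s = (if s \<le> b then if s \<le> a then f1 s else g s else f2 s)" for s
    have "L-lipschitz_on {a - \<delta>..b} (\<lambda>s. if s \<le> a then f1 s else g s)"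
      using f1(1,2) g(1) pos unfolding In
      by (intro lipschitz_on_concat) (auto intro: lipschitz_on_subset)
    moreover have "L-lipschitz_on {b..b + \<delta>} f2"
      using f2(1) pos by (auto intro: lipschitz_on_subset)
    \<comment> \<open>For \<open>n = 0\<close> the old interval is the single point
      \<open>a = b\<close>, so the left piece is evaluated at its own gluing point; its value there
      is still \<open>g a\<close>.\<close>
    moreover have "(if b \<le> a then f1 b else g b) = f2 b"
      using ab f1(2) f2(2) by (cases "a = b") auto
    ultimately have "L-lipschitz_on (I (Suc n)) h"
      unfolding h_def ISuc by (rule lipschitz_on_concat)
    moreover have "h s0 = y0" using ab f1(2) g(2) by (auto simp: h_def)
    moreover have "(frac s, h s) \<in> K" if "s \<in> I (Suc n)" for s
      using that f1(3) f2(3) g(3) pos ab by (auto simp: h_def In ISuc)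
    ultimately show ?case by blast
  qed
  then obtain g where g: "\<And>n. L-lipschitz_on (I n) (g n)" "\<And>n. g n s0 = y0"
      "\<And>n s. s \<in> I n \<Longrightarrow> (frac s, g n s) \<in> K"
    by metis
  have I_mono: "I m \<subseteq> I n" if "m \<le> n" for m n
  proof -
    have "real m * \<delta> \<le> real n * \<delta>" using that pos by (intro mult_right_mono) auto
    then show ?thesis by (auto simp: I_def)
  qed
  \<comment> \<open>The curves \<open>g n\<close> were chosen independently of each other. All pass
    through \<open>y0\<close> over \<open>s0\<close>, so uniqueness forces each to extend the
    earlier ones.\<close>
  have agree: "g m s = g n s" if "m \<le> n" "s \<in> I m" for m n s
  proof (rule graphs_in_separated_fibres_agree[where I = "I m" and p = s0 and K = K and \<epsilon> = \<epsilon>])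
    show "continuous_on (I m) (g m)" "continuous_on (I m) (g n)"
      using g(1) I_mono[OF that(1)] lipschitz_on_continuous_on lipschitz_on_subset by blast+
    show "connected (I m)" unfolding I_def by simp
    show "(frac s, g n s) \<in> K" if "s \<in> I m" for s
      using that I_mono[OF \<open>m \<le> n\<close>] g(3) by blast
  qed (use that s0 g sep pos in auto)
  \<comment> \<open>\<open>N s\<close> is the least index whose interval contains \<open>s\<close>.
    Two parameters are compared on the larger of their intervals, where both values come from one
    curve.\<close>
  define N where "N s = nat \<lceil>\<bar>s - s0\<bar> / \<delta>\<rceil>" for s
  have N: "s \<in> I (N s)" for s
  proof -
    have "\<bar>s - s0\<bar> / \<delta> \<le> real (N s)" unfolding N_def by linarith
    then have "\<bar>s - s0\<bar> \<le> real (N s) * \<delta>" using pos by (simp add: divide_simps)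
    then show ?thesis unfolding I_def by auto
  qed
  show thesis
  proof (rule that[of "\<lambda>s. g (N s) s"])
    show "L-lipschitz_on UNIV (\<lambda>s. g (N s) s)"
    proof (rule lipschitz_onI)
      fix s t :: real
      define m where "m = max (N s) (N t)"
      have "s \<in> I m" "t \<in> I m" using N I_mono[of "N s" m] I_mono[of "N t" m] by (auto simp: m_def)
      moreover have "g (N s) s = g m s" "g (N t) t = g m t"
        using N by (auto intro!: agree simp: m_def)
      ultimately show "dist (g (N s) s) (g (N t) t) \<le> L * dist s t"
        using lipschitz_onD[OF g(1)] by metis
    qed (use g(1) lipschitz_on_nonneg in blast)
  qed (use g N in auto)
qed

text \<open>A section over the whole line is determined by its value at \<open>0\<close>, so the
  finite fibre there leaves finitely many sections. The values of one section at natural numbers lie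
  in the same fibre; a repetition at \<open>m < n\<close> and uniqueness make \<open>n - m\<close> a
  period. Continuation puts every point of \<open>K\<close> on a section.\<close>

lemma finite_union_of_periodic_curves:
  fixes K :: "(real \<times> 'a::metric_space) set"
  assumes extend: "\<And>s y. (frac s, y) \<in> K \<Longrightarrow> \<exists>f. L-lipschitz_on {s - \<delta>..s + \<delta>} f \<and> f s = y \<and>
                   (\<forall>s'\<in>{s - \<delta>..s + \<delta>}. (frac s', f s') \<in> K)"
    and sep: "\<And>s y y'. (s, y) \<in> K \<Longrightarrow> (s, y') \<in> K \<Longrightarrow> y \<noteq> y' \<Longrightarrow> \<epsilon> \<le> dist y y'"
    and pos: "0 < \<delta>" "0 < \<epsilon>"
    and fin: "finite (K `` {0})" and K: "fst ` K \<subseteq> {0..<1}"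
  shows "\<exists>(r::nat) (\<phi>::nat \<Rightarrow> real \<Rightarrow> 'a) (\<tau>::nat \<Rightarrow> nat).
           (\<forall>i\<in>{1..r}. \<tau> i > 0 \<and> (\<exists>L. L-lipschitz_on UNIV (\<phi> i)) \<and>
                         (\<forall>s. \<phi> i (s + real (\<tau> i)) = \<phi> i s)) \<and>
           K = (\<Union>i\<in>{1..r}. periodic_curve (\<phi> i) (\<tau> i)) \<and>
           inj_on (\<lambda>i. periodic_curve (\<phi> i) (\<tau> i)) {1..r}"
proof -
  define S where "S = {\<phi>. L-lipschitz_on UNIV \<phi> \<and> (\<forall>s. (frac s, \<phi> s) \<in> K)}"
  have uniq: "\<phi> = \<psi>" if "continuous_on UNIV \<phi>" "continuous_on UNIV \<psi>"
      "\<And>s. (frac s, \<phi> s) \<in> K" "\<And>s. (frac s, \<psi> s) \<in> K" "\<phi> p = \<psi> p" for \<phi> \<psi> p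
    by (rule ext, rule graphs_in_separated_fibres_agree[where I = UNIV and p = p and K = K and \<epsilon> = \<epsilon>])
       (use that sep pos in auto)
  have S_cont: "continuous_on UNIV \<phi>" if "\<phi> \<in> S" for \<phi>
    using that lipschitz_on_continuous_on by (auto simp: S_def)
  have S_K: "(frac s, \<phi> s) \<in> K" if "\<phi> \<in> S" for \<phi> s
    using that by (auto simp: S_def)
  have "inj_on (\<lambda>\<phi>. \<phi> 0) S"
    using uniq[of _ _ 0] S_cont S_K by (intro inj_onI) metis
  moreover have "(\<lambda>\<phi>. \<phi> 0) ` S \<subseteq> K `` {0}"
    using S_K[of _ 0] by auto
  ultimately have finS: "finite S" using fin inj_on_finite by blast
  have "\<exists>n>0. \<forall>s. \<phi> (s + real n) = \<phi> s" if "\<phi> \<in> S" for \<phi>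
  proof -
    have "\<phi> (real n) \<in> K `` {0}" for n :: nat
      using S_K[OF that, of "real n"] by (simp add: frac_def)
    then have "range (\<lambda>n::nat. \<phi> (real n)) \<subseteq> K `` {0}" by blast
    then have "\<not> inj (\<lambda>n::nat. \<phi> (real n))"
      using fin finite_subset finite_imageD infinite_UNIV_nat by blast
    then obtain m n where mn: "m < n" "\<phi> (real m) = \<phi> (real n)"
      unfolding inj_def by (metis linorder_neqE_nat)
    have shift: "continuous_on UNIV (\<lambda>s. \<phi> (s + real k))" "(frac s, \<phi> (s + real k)) \<in> K" for k s
    proof -
      show "continuous_on UNIV (\<lambda>s. \<phi> (s + real k))"
        by (rule continuous_on_compose2[OF S_cont[OF that]]) (auto intro!: continuous_intros)
      show "(frac s, \<phi> (s + real k)) \<in> K"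
        using S_K[OF that, of "s + real k"] by (simp add: frac_def)
    qed
    have eq: "(\<lambda>s. \<phi> (s + real m)) = (\<lambda>s. \<phi> (s + real n))"
      using mn by (intro uniq[where p = 0] shift) auto
    have "\<phi> (s + real (n - m)) = \<phi> s" for s
      using fun_cong[OF eq, of "s - real m"] mn(1) by (simp add: of_nat_diff algebra_simps)
    then show ?thesis using mn(1) by (intro exI[of _ "n - m"]) auto
  qed
  then obtain T where T: "\<And>\<phi>. \<phi> \<in> S \<Longrightarrow> T \<phi> > 0" "\<And>\<phi> s. \<phi> \<in> S \<Longrightarrow> \<phi> (s + real (T \<phi>)) = \<phi> s"
    by metis
  \<comment> \<open>Distinct sections may trace the same curve, as a section and its integer
    translates do. Enumerating the set of curves instead of the sections makes the listed curves
    pairwise distinct.\<close>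
  define C where "C = (\<lambda>\<phi>. periodic_curve \<phi> (T \<phi>)) ` S"
  have K_eq: "K = \<Union>C"
  proof
    show "K \<subseteq> \<Union>C"
    proof
      fix z assume z: "z \<in> K"
      obtain s y where sy: "z = (s, y)" by (cases z)
      have s: "s \<in> {0..<1}" using K z sy by force
      then have fs: "frac s = s" by (simp add: frac_eq)
      obtain \<phi> where \<phi>: "L-lipschitz_on UNIV \<phi>" "\<phi> s = y" "\<And>s. (frac s, \<phi> s) \<in> K"
      proof (rule ex_lipschitz_section[where K = K and ?s0.0 = s and ?y0.0 = y])
        show "\<exists>f. L-lipschitz_on {s - \<delta>..s + \<delta>} f \<and> f s = y \<and>
            (\<forall>s'\<in>{s - \<delta>..s + \<delta>}. (frac s', f s') \<in> K)" if "(frac s, y) \<in> K" for s y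
          using that by (rule extend)
        show "\<epsilon> \<le> dist y y'" if "(s, y) \<in> K" "(s, y') \<in> K" "y \<noteq> y'" for s y y'
          using that by (rule sep)
        show "(frac s, y) \<in> K" using z sy fs by simp
      qed (use pos in auto)
      then have "\<phi> \<in> S" by (auto simp: S_def)
      moreover have "z \<in> periodic_curve \<phi> (T \<phi>)"
        using T(1)[OF \<open>\<phi> \<in> S\<close>] s fs \<phi>(2) sy unfolding periodic_curve_def
        by (auto intro!: exI[of _ s])
      ultimately show "z \<in> \<Union>C" by (auto simp: C_def)
    qed
    show "\<Union>C \<subseteq> K" using S_K by (auto simp: C_def periodic_curve_def)
  qed
  have "finite C" using finS by (simp add: C_def)
  then obtain e where e: "bij_betw e {1..card C} C"
    using ex_bij_betw_nat_finite_1 by blast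
  define \<phi> where "\<phi> i = (SOME \<phi>. \<phi> \<in> S \<and> e i = periodic_curve \<phi> (T \<phi>))" for i
  have \<phi>: "\<phi> i \<in> S \<and> e i = periodic_curve (\<phi> i) (T (\<phi> i))" if "i \<in> {1..card C}" for i
  proof -
    have "e i \<in> C" using e that bij_betwE by blast
    then show ?thesis unfolding \<phi>_def C_def by (intro someI_ex[of "\<lambda>\<phi>. \<phi> \<in> S \<and> _ \<phi>"]) auto
  qed
  have "inj_on (\<lambda>i. periodic_curve (\<phi> i) (T (\<phi> i))) {1..card C}"
    using bij_betw_imp_inj_on[OF e] \<phi> by (subst inj_on_cong[of _ _ e]) auto
  moreover have "K = (\<Union>i\<in>{1..card C}. periodic_curve (\<phi> i) (T (\<phi> i)))"
    using K_eq bij_betw_imp_surj_on[OF e] \<phi> by auto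
  moreover have "\<forall>i\<in>{1..card C}. T (\<phi> i) > 0 \<and> (\<exists>L. L-lipschitz_on UNIV (\<phi> i)) \<and>
      (\<forall>s. \<phi> i (s + real (T (\<phi> i))) = \<phi> i s)"
    using \<phi> T unfolding S_def by blast
  ultimately show ?thesis
    by (intro exI[of _ "card C"] exI[of _ \<phi>] exI[of _ "\<lambda>i. T (\<phi> i)"]) blast
qed

section \<open>Measurability of events about fibres\<close>

lemma temb_inj_on: "inj_on temb circ_space"
proof (rule inj_onI)
  fix z w :: "real \<times> 'a"
  assume zw: "z \<in> circ_space" "w \<in> circ_space" "temb z = temb w"
  then have "cis (2 * pi * fst z) = cis (2 * pi * fst w)" by (simp add: temb_def)
  then obtain n :: int where "2 * pi * fst z = 2 * pi * fst w + 2 * pi * n"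
    using sin_cos_eq_iff[of "2 * pi * fst z" "2 * pi * fst w"]
    by (auto simp: complex_eq_iff)
  then have "2 * pi * fst z = 2 * pi * (fst w + n)" by (simp add: algebra_simps)
  then have "fst z = fst w + n" by simp
  moreover have "0 \<le> fst z" "fst z < 1" "0 \<le> fst w" "fst w < 1" using zw by auto
  ultimately have "- 1 < real_of_int n" "real_of_int n < 1" by linarith+
  then have "n = 0" by simp
  then have "fst z = fst w" using \<open>fst z = fst w + n\<close> by simp
  then show "z = w" using zw(3) by (simp add: temb_def prod_eq_iff)
qed

text \<open>Measurability of \<open>X\<close> is given through distances to fixed points. If the
  compact image of \<open>X \<omega>\<close> misses the closed image of the ball in the fibre, the
  two have positive distance. A hit is therefore detected by arbitrarily small distances at
  countably many points dense in the ball.\<close>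

lemma fibre_hits_cball_measurable:
  fixes X :: "'w \<Rightarrow> (real \<times> 'd::euclidean_space) set"
  assumes X: "random_compact_set_circ P X" and ne: "\<And>\<omega>. \<omega> \<in> space P \<Longrightarrow> X \<omega> \<noteq> {}"
    and s: "s \<in> {0..<1}"
  shows "{\<omega> \<in> space P. \<exists>y\<in>cball q r. (s, y) \<in> X \<omega>} \<in> sets P"
proof -
  obtain T where T: "countable T" "T \<subseteq> cball q r" "cball q r \<subseteq> closure T"
    using separable[of "cball q r"] by metis
  have iff: "(\<exists>y\<in>cball q r. (s, y) \<in> X \<omega>) \<longleftrightarrow>
      (\<forall>n::nat. \<exists>y\<in>T. infdist (temb (s, y)) (temb ` X \<omega>) < 1 / real (Suc n))"
    (is "?L \<longleftrightarrow> ?R") if \<omega>: "\<omega> \<in> space P" for \<omega>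
  proof
    assume ?L
    then obtain y where y: "y \<in> cball q r" "(s, y) \<in> X \<omega>" by blast
    show ?R
    proof
      fix n :: nat
      obtain y' where y': "y' \<in> T" "dist y' y < 1 / real (Suc n)"
        using y(1) T(3) closure_approachable[of y T] by (metis subsetD zero_less_divide_1_iff of_nat_0_less_iff zero_less_Suc)
      have "infdist (temb (s, y')) (temb ` X \<omega>) \<le> dist (temb (s, y')) (temb (s, y))"
        using y(2) by (intro infdist_le) auto
      also have "\<dots> = dist y' y" by (simp add: temb_def dist_Pair_Pair)
      finally show "\<exists>y\<in>T. infdist (temb (s, y)) (temb ` X \<omega>) < 1 / real (Suc n)"
        using y' by force
    qed
  next
    assume R: ?R
    show ?L
    proof (rule ccontr)
      assume no: "\<not> ?L"
      have Xc: "X \<omega> \<subseteq> circ_space" "compact (temb ` X \<omega>)"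
        using X \<omega> by (auto simp: random_compact_set_circ_def)
      have "temb ` ({s} \<times> cball q r) = {cis (2 * pi * s)} \<times> cball q r"
        by (force simp: temb_def)
      then have "closed (temb ` ({s} \<times> cball q r))"
        by (simp add: closed_Times)
      moreover have "temb ` X \<omega> \<inter> temb ` ({s} \<times> cball q r) = {}"
      proof -
        have "temb ` X \<omega> \<inter> temb ` ({s} \<times> cball q r) = temb ` (X \<omega> \<inter> ({s} \<times> cball q r))"
          using Xc(1) s by (intro inj_on_image_Int[OF temb_inj_on, symmetric]) auto
        then show ?thesis using no by auto
      qed
      ultimately obtain d where d: "d > 0"
        "\<And>u v. u \<in> temb ` X \<omega> \<Longrightarrow> v \<in> temb ` ({s} \<times> cball q r) \<Longrightarrow> d \<le> dist u v"
        using separate_compact_closed[OF Xc(2)] by metis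
      obtain n :: nat where n: "1 / real (Suc n) < d"
        using d(1) nat_approx_posE by blast
      obtain y where y: "y \<in> T" "infdist (temb (s, y)) (temb ` X \<omega>) < 1 / real (Suc n)"
        using R by blast
      have "d \<le> infdist (temb (s, y)) (temb ` X \<omega>)"
      proof -
        have "temb (s, y) \<in> temb ` ({s} \<times> cball q r)" using y(1) T(2) by blast
        then have "d \<le> dist (temb (s, y)) u" if "u \<in> temb ` X \<omega>" for u
          using d(2)[OF that] by (metis dist_commute)
        then show ?thesis
          using ne[OF \<omega>] by (subst infdist_notempty) (auto intro!: cINF_greatest)
      qed
      then show False using y n by simp
    qed
  qed
  have "{\<omega> \<in> space P. \<forall>n::nat. \<exists>y\<in>T. infdist (temb (s, y)) (temb ` X \<omega>) < 1 / real (Suc n)} \<in> sets P"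
  proof (intro sets.sets_Collect_countable_All sets.sets_Collect_countable_Ex' T(1) ballI)
    fix n :: nat and y assume "y \<in> T"
    have [measurable]: "(\<lambda>\<omega>. infdist (temb (s, y)) (temb ` X \<omega>)) \<in> borel_measurable P"
      using X s by (auto simp: random_compact_set_circ_def)
    show "{\<omega> \<in> space P. infdist (temb (s, y)) (temb ` X \<omega>) < 1 / real (Suc n)} \<in> sets P"
      by measurable
  qed
  also have "{\<omega> \<in> space P. \<forall>n::nat. \<exists>y\<in>T. infdist (temb (s, y)) (temb ` X \<omega>) < 1 / real (Suc n)}
      = {\<omega> \<in> space P. \<exists>y\<in>cball q r. (s, y) \<in> X \<omega>}"
    using iff by blast
  finally show ?thesis .
qed

text \<open>Two distinct points closer than \<open>a\<close> lie in small disjoint balls around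
  points of a countable dense set, chosen so that any pair of points from them is closer than
  \<open>a\<close>. The event is thus a countable union of intersections of ball-hitting
  events.\<close>

lemma close_pair_measurable:
  fixes X :: "'w \<Rightarrow> (real \<times> 'd::euclidean_space) set"
  assumes X: "random_compact_set_circ P X" "\<And>\<omega>. \<omega> \<in> space P \<Longrightarrow> X \<omega> \<noteq> {}" "s \<in> {0..<1}"
  shows "{\<omega> \<in> space P. \<exists>y y'. (s, y) \<in> X \<omega> \<and> (s, y') \<in> X \<omega> \<and> y \<noteq> y' \<and> dist y y' < a} \<in> sets P"
proof -
  obtain D :: "'d set" where D: "countable D" "\<And>U. open U \<Longrightarrow> U \<noteq> {} \<Longrightarrow> \<exists>d\<in>D. d \<in> U"
    using countable_dense_setE by blast
  define E where "E q n = {\<omega> \<in> space P. \<exists>y\<in>cball q (1 / real (Suc n)). (s, y) \<in> X \<omega>}" for q n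
  \<comment> \<open>Passing from centres to points of the balls changes a distance by at most two
    radii. The first inequality keeps the points distinct, the second keeps them closer than
    \<open>a\<close>.\<close>
  define J where "J = {(q, q', n). q \<in> D \<and> q' \<in> D \<and> 2 / real (Suc n) < dist q q' \<and>
                         dist q q' + 2 / real (Suc n) < a}"
  have "countable (D \<times> D \<times> (UNIV :: nat set))" using D(1) by simp
  then have "countable J" by (rule countable_subset[rotated]) (auto simp: J_def)
  moreover have "E q n \<in> sets P" for q n
    unfolding E_def using X by (rule fibre_hits_cball_measurable)
  ultimately have "(\<Union>(q, q', n)\<in>J. E q n \<inter> E q' n) \<in> sets P"
    by (intro sets.countable_UN'') auto
  also have "(\<Union>(q, q', n)\<in>J. E q n \<inter> E q' n) =
    {\<omega> \<in> space P. \<exists>y y'. (s, y) \<in> X \<omega> \<and> (s, y') \<in> X \<omega> \<and> y \<noteq> y' \<and> dist y y' < a}" (is "?U = ?V")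
  proof
    show "?U \<subseteq> ?V"
    proof
      fix \<omega> assume "\<omega> \<in> ?U"
      then obtain q q' n y y' where *: "(q, q', n) \<in> J" "\<omega> \<in> space P" "(s, y) \<in> X \<omega>" "(s, y') \<in> X \<omega>"
        "dist q y \<le> 1 / real (Suc n)" "dist q' y' \<le> 1 / real (Suc n)"
        by (auto simp: E_def)
      have J: "2 * (1 / real (Suc n)) < dist q q'" "dist q q' + 2 * (1 / real (Suc n)) < a"
        using *(1) by (auto simp: J_def)
      have "dist q q' \<le> dist q y + dist y y' + dist q' y'"
        "dist y y' \<le> dist q y + dist q q' + dist q' y'"
        by metric+
      then have "0 < dist y y'" "dist y y' < a" using J *(5,6) by linarith+
      then show "\<omega> \<in> ?V" using *(2-4) by auto
    qed
    show "?V \<subseteq> ?U"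
    proof
      fix \<omega> assume "\<omega> \<in> ?V"
      then obtain y y' where y: "\<omega> \<in> space P" "(s, y) \<in> X \<omega>" "(s, y') \<in> X \<omega>" "y \<noteq> y'" "dist y y' < a"
        by blast
      \<comment> \<open>A quarter, because replacing the points by centres costs two radii and the
        margins in \<open>J\<close> cost two more.\<close>
      have "0 < min (dist y y' / 4) ((a - dist y y') / 4)" using y by simp
      then obtain n :: nat where "1 / real (Suc n) < min (dist y y' / 4) ((a - dist y y') / 4)"
        using nat_approx_posE by blast
      then have n: "4 * (1 / real (Suc n)) < dist y y'" "4 * (1 / real (Suc n)) < a - dist y y'"
        by auto
      obtain q where q: "q \<in> D" "dist y q < 1 / real (Suc n)"
        using D(2)[of "ball y (1 / real (Suc n))"] by auto
      obtain q' where q': "q' \<in> D" "dist y' q' < 1 / real (Suc n)"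
        using D(2)[of "ball y' (1 / real (Suc n))"] by auto
      have "dist q q' \<le> dist y q + dist y y' + dist y' q'"
        "dist y y' \<le> dist y q + dist q q' + dist y' q'"
        by metric+
      then have "2 * (1 / real (Suc n)) < dist q q'" "dist q q' + 2 * (1 / real (Suc n)) < a"
        using n q q' by linarith+
      then have "(q, q', n) \<in> J" using q q' by (auto simp: J_def)
      moreover have "\<omega> \<in> E q n \<inter> E q' n"
        using y(1-3) less_imp_le[OF q(2)] less_imp_le[OF q'(2)]
        unfolding E_def mem_cball by (auto simp: dist_commute)
      ultimately show "\<omega> \<in> ?U" by blast
    qed
  qed
  finally show ?thesis .
qed

section \<open>Almost sure separation of contracted random fibres\<close>

lemma mds_space: "metric_dynamical_system P \<theta> \<Longrightarrow> \<omega> \<in> space P \<Longrightarrow> \<theta> t \<omega> \<in> space P"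
  unfolding metric_dynamical_system_def by (meson measurable_space)

lemma mds_add: "metric_dynamical_system P \<theta> \<Longrightarrow> \<omega> \<in> space P \<Longrightarrow> \<theta> t (\<theta> u \<omega>) = \<theta> (t + u) \<omega>"
  unfolding metric_dynamical_system_def by simp

lemma mds_zero: "metric_dynamical_system P \<theta> \<Longrightarrow> \<omega> \<in> space P \<Longrightarrow> \<theta> 0 \<omega> = \<omega>"
  unfolding metric_dynamical_system_def by simp

text \<open>Every shift preserves \<open>P\<close>, and only countably many null sets are united.
  Integer times cover both the backward orbit, used for finiteness, and the forward orbit, used for
  separation.\<close>

lemma mds_AE_orbit:
  assumes "metric_dynamical_system P \<theta>" "AE \<omega> in P. Q \<omega>"
  shows "AE \<omega> in P. \<forall>k::int. Q (\<theta> (of_int k * p) \<omega>)"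
  unfolding AE_all_countable
proof
  fix k :: int
  have T: "\<theta> (of_int k * p) \<in> P \<rightarrow>\<^sub>M P" "distr P P (\<theta> (of_int k * p)) = P"
    using assms(1) by (auto simp: metric_dynamical_system_def)
  show "AE \<omega> in P. Q (\<theta> (of_int k * p) \<omega>)"
    by (rule AE_distrD[OF T(1)]) (use assms(2) in \<open>simp only: T(2)\<close>)
qed

text \<open>\<open>g \<omega> s\<close> is the fibre map over time \<open>p\<close>, a time after
  which the circle coordinate has made whole turns, so \<open>s\<close> stays fixed. A positive
  \<open>lam\<close> keeps distances strictly below the thresholds
  \<open>lam ^ k * \<epsilon>\<close> after each step.\<close>

locale fibre_contraction =
  fixes P :: "'w measure" and \<theta> :: "real \<Rightarrow> 'w \<Rightarrow> 'w"
    and X :: "'w \<Rightarrow> (real \<times> 'd::euclidean_space) set"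
    and g :: "'w \<Rightarrow> real \<Rightarrow> 'd \<Rightarrow> 'd" and p b lam \<epsilon> :: real
  assumes mds: "metric_dynamical_system P \<theta>"
    and X: "random_compact_set_circ P X"
    and X_ne: "\<And>\<omega>. \<omega> \<in> space P \<Longrightarrow> X \<omega> \<noteq> {}"
    and diam: "\<And>\<omega> s y y'. \<lbrakk>\<omega> \<in> space P; (s, y) \<in> X \<omega>; (s, y') \<in> X \<omega>\<rbrakk> \<Longrightarrow> dist y y' \<le> b"
    and onto: "\<And>\<omega> s. \<omega> \<in> space P \<Longrightarrow> g \<omega> s ` (X \<omega> `` {s}) = X (\<theta> p \<omega>) `` {s}"
    and inj: "\<And>\<omega> s. \<omega> \<in> space P \<Longrightarrow> inj_on (g \<omega> s) (X \<omega> `` {s})"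
    and contr: "AE \<omega> in P. \<forall>s y y'. (s, y) \<in> X \<omega> \<longrightarrow> (s, y') \<in> X \<omega> \<longrightarrow> dist y y' \<le> \<epsilon> \<longrightarrow>
                  dist (g \<omega> s y) (g \<omega> s y') \<le> lam * dist y y'"
    and lam: "0 < lam" "lam < 1" and eps: "0 < \<epsilon>"
begin

lemma contr_orbit: "AE \<omega> in P. \<forall>k::int. \<forall>s y y'. (s, y) \<in> X (\<theta> (k * p) \<omega>) \<longrightarrow>
    (s, y') \<in> X (\<theta> (k * p) \<omega>) \<longrightarrow> dist y y' \<le> \<epsilon> \<longrightarrow>
    dist (g (\<theta> (k * p) \<omega>) s y) (g (\<theta> (k * p) \<omega>) s y') \<le> lam * dist y y'"
  by (rule mds_AE_orbit[OF mds contr])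

text \<open>The fibre at \<omega> is an \<open>n\<close>-fold image of the fibre over the same
  \<open>s\<close> at time \<open>- n * p\<close>, for every \<open>n\<close>, so backward
  contraction applies. The exceptional null set does not depend on \<open>s\<close>, since
  \<open>contr\<close> holds for all \<open>s\<close> at once.\<close>

lemma AE_finite_fibres: "AE \<omega> in P. \<forall>s. finite (X \<omega> `` {s})"
  using contr_orbit AE_space
proof eventually_elim
  case (elim \<omega>)
  show ?case
  proof
    fix s
    define w where "w n = \<theta> (of_int (- int n) * p) \<omega>" for n
    have w: "w n \<in> space P" for n using mds_space[OF mds elim(2)] by (simp add: w_def)
    have step: "\<theta> p (w (Suc n)) = w n" for n
      unfolding w_def mds_add[OF mds elim(2)] by (simp add: algebra_simps)
    have "finite (X (w 0) `` {s})"
    proof (rule finite_of_backward_contraction[where g = "\<lambda>n. g (w (Suc n)) s" and b = b])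
      show "g (w (Suc n)) s ` (X (w (Suc n)) `` {s}) = X (w n) `` {s}" for n
        using onto[OF w] by (simp add: step)
      show "dist x y \<le> b" if "x \<in> X (w n) `` {s}" "y \<in> X (w n) `` {s}" for n x y
        using that diam[OF w] by blast
      show "dist (g (w (Suc n)) s x) (g (w (Suc n)) s y) \<le> lam * dist x y"
        if "x \<in> X (w (Suc n)) `` {s}" "y \<in> X (w (Suc n)) `` {s}" "dist x y \<le> \<epsilon>" for n x y
        using that elim(1)[rule_format, of s x "- int (Suc n)" y] unfolding w_def by blast
    qed (use lam eps in auto)
    then show "finite (X \<omega> `` {s})" using mds_zero[OF mds elim(2)] by (simp add: w_def)
  qed
qed

text \<open>A close pair contracts by \<open>lam\<close> at each forward step and stays a pair of
  distinct points by injectivity, so \<open>A 0\<close> recurs into the shrinking events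
  \<open>A k\<close>. The point \<open>s\<close> is fixed because these events are measurable for a
  given \<open>s\<close>.\<close>

lemma AE_fibre_separated:
  assumes s: "s \<in> {0..<1}"
  shows "AE \<omega> in P. \<forall>y y'. (s, y) \<in> X \<omega> \<longrightarrow> (s, y') \<in> X \<omega> \<longrightarrow> y \<noteq> y' \<longrightarrow> \<epsilon> \<le> dist y y'"
proof -
  define A where "A k = {\<omega> \<in> space P. \<exists>y y'. (s, y) \<in> X \<omega> \<and> (s, y') \<in> X \<omega> \<and> y \<noteq> y' \<and>
      dist y y' < lam ^ k * \<epsilon>}" for k :: nat
  have pow: "lam ^ n * \<epsilon> \<le> lam ^ m * \<epsilon>" if "m \<le> n" for m n
    using that lam eps by (intro mult_right_mono power_decreasing) auto
  have "AE \<omega> in P. \<omega> \<notin> A 0"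
  \<comment> \<open>The times are cast through the integers to match
    \<open>contr_orbit\<close>.\<close>
  proof (rule AE_notin_of_shrinking_recurrence[where T = "\<lambda>k. \<theta> (of_int (int k) * p)"])
    show "prob_space P" "\<And>k. \<theta> (of_int (int k) * p) \<in> P \<rightarrow>\<^sub>M P"
        "\<And>k. distr P P (\<theta> (of_int (int k) * p)) = P"
      using mds by (auto simp: metric_dynamical_system_def)
    show "A k \<in> sets P" for k
      unfolding A_def using X X_ne s by (rule close_pair_measurable)
    show "decseq A"
    proof (rule decseq_SucI)
      show "A (Suc k) \<subseteq> A k" for k
        using pow[of k "Suc k"] unfolding A_def by fastforce
    qed
    show "AE \<omega> in P. \<forall>k. \<omega> \<in> A 0 \<longrightarrow> \<theta> (of_int (int k) * p) \<omega> \<in> A k"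
      using contr_orbit AE_space
    proof eventually_elim
      case (elim \<omega>)
      show ?case
      proof (intro allI impI)
        fix k assume A0: "\<omega> \<in> A 0"
        show "\<theta> (of_int (int k) * p) \<omega> \<in> A k"
        proof (induction k)
          case 0
          then show ?case using A0 mds_zero[OF mds elim(2)] by simp
        next
          case (Suc k)
          define v where "v = \<theta> (of_int (int k) * p) \<omega>"
          have v: "v \<in> space P" using mds_space[OF mds elim(2)] by (simp add: v_def)
          have next_v: "\<theta> (of_int (int (Suc k)) * p) \<omega> = \<theta> p v"
            unfolding v_def mds_add[OF mds elim(2)] by (simp add: algebra_simps)
          obtain y y' where y: "(s, y) \<in> X v" "(s, y') \<in> X v" "y \<noteq> y'" "dist y y' < lam ^ k * \<epsilon>"
            using Suc by (auto simp: A_def v_def)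
          have "dist y y' \<le> \<epsilon>" using y(4) pow[of 0 k] by simp
          then have "dist (g v s y) (g v s y') \<le> lam * dist y y'"
            using elim(1)[rule_format, of s y "int k" y'] y(1,2) unfolding v_def by blast
          also have "\<dots> < lam ^ Suc k * \<epsilon>" using y(4) lam by (simp add: mult.assoc)
          finally have "dist (g v s y) (g v s y') < lam ^ Suc k * \<epsilon>" .
          moreover have "(s, g v s y) \<in> X (\<theta> p v)" "(s, g v s y') \<in> X (\<theta> p v)"
            using onto[OF v, of s] y(1,2) by blast+
          moreover have "g v s y \<noteq> g v s y'"
            using inj_onD[OF inj[OF v, of s]] y(1-3) by blast
          ultimately show ?case
            using mds_space[OF mds v] unfolding next_v A_def by blast
        qed
      qed
    qed
    \<comment> \<open>A finite fibre has a positive gap, and the thresholds eventually fall below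
      it.\<close>
    show "AE \<omega> in P. \<exists>k. \<omega> \<notin> A k"
      using AE_finite_fibres
    proof eventually_elim
      case (elim \<omega>)
      then have "uniform_discrete (X \<omega> `` {s})" using uniform_discrete_finite_iff by blast
      then obtain d where d: "0 < d" "\<And>y y'. (s, y) \<in> X \<omega> \<Longrightarrow> (s, y') \<in> X \<omega> \<Longrightarrow> dist y y' < d \<Longrightarrow> y = y'"
        unfolding uniform_discrete_def by blast
      have "(\<lambda>n. lam ^ n * \<epsilon>) \<longlonglongrightarrow> 0 * \<epsilon>"
        using lam by (intro tendsto_intros LIMSEQ_realpow_zero) auto
      then obtain k where "lam ^ k * \<epsilon> < d"
        using order_tendstoD(2)[of _ 0 sequentially d] d(1)
        by (auto simp: eventually_sequentially)
      then have "\<omega> \<notin> A k" using d(2) unfolding A_def by fastforce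
      then show ?case ..
    qed
  qed
  then show ?thesis
    using AE_space by eventually_elim (force simp: A_def)
qed

text \<open>One null set serves the countably many rational \<open>s\<close>. Local curves through a
  close pair over any other \<open>s\<close> stay distinct and close over nearby parameters, among
  them a rational one.\<close>

lemma AE_fibres_separated:
  assumes "0 < \<delta>"
    and loc: "\<And>\<omega> s y. \<omega> \<in> space P \<Longrightarrow> (s, y) \<in> X \<omega> \<Longrightarrow>
      \<exists>f. continuous_on UNIV f \<and> f s = y \<and> (\<forall>s'\<in>{s - \<delta>..s + \<delta>}. (frac s', f s') \<in> X \<omega>)"
  shows "AE \<omega> in P. \<forall>s y y'. (s, y) \<in> X \<omega> \<longrightarrow> (s, y') \<in> X \<omega> \<longrightarrow> y \<noteq> y' \<longrightarrow> \<epsilon> \<le> dist y y'"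
proof -
  have "AE \<omega> in P. \<forall>s\<in>{0..<1} \<inter> \<rat>. \<forall>y y'. (s, y) \<in> X \<omega> \<longrightarrow> (s, y') \<in> X \<omega> \<longrightarrow> y \<noteq> y' \<longrightarrow> \<epsilon> \<le> dist y y'"
    using AE_fibre_separated countable_rat by (intro AE_ball_countable') auto
  then show ?thesis using AE_space
  proof eventually_elim
    case (elim \<omega>)
    show ?case
    proof (intro allI impI, rule ccontr)
      fix s y y'
      assume y: "(s, y) \<in> X \<omega>" "(s, y') \<in> X \<omega>" "y \<noteq> y'" "\<not> \<epsilon> \<le> dist y y'"
      have "X \<omega> \<subseteq> circ_space" using X elim(2) by (simp add: random_compact_set_circ_def)
      then have s: "0 \<le> s" "s < 1" using y(1) by auto
      obtain f where f: "continuous_on UNIV f" "f s = y" "\<And>s'. s' \<in> {s - \<delta>..s + \<delta>} \<Longrightarrow> (frac s', f s') \<in> X \<omega>"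
        using loc[OF elim(2) y(1)] by blast
      obtain f' where f': "continuous_on UNIV f'" "f' s = y'" "\<And>s'. s' \<in> {s - \<delta>..s + \<delta>} \<Longrightarrow> (frac s', f' s') \<in> X \<omega>"
        using loc[OF elim(2) y(2)] by blast
      have "continuous_on UNIV (\<lambda>t. dist (f t) (f' t))"
        using f(1) f'(1) by (intro continuous_intros)
      \<comment> \<open>The limit is taken from the right because \<open>s\<close> may be
        \<open>0\<close>, the left end of the fundamental interval.\<close>
      then have lim: "((\<lambda>t. dist (f t) (f' t)) \<longlongrightarrow> dist (f s) (f' s)) (at_right s)"
        by (auto simp: continuous_on_def intro: tendsto_within_subset)
      have "\<forall>\<^sub>F t in at_right s. 0 < dist (f t) (f' t)" "\<forall>\<^sub>F t in at_right s. dist (f t) (f' t) < \<epsilon>"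
        using y f(2) f'(2) order_tendstoD(1)[OF lim, of 0] order_tendstoD(2)[OF lim, of \<epsilon>] by auto
      then have "\<forall>\<^sub>F t in at_right s. 0 < dist (f t) (f' t) \<and> dist (f t) (f' t) < \<epsilon>"
        by (rule eventually_conj)
      then obtain c where c: "s < c" "\<And>t. s < t \<Longrightarrow> t < c \<Longrightarrow> 0 < dist (f t) (f' t) \<and> dist (f t) (f' t) < \<epsilon>"
        unfolding eventually_at_right_field by blast
      \<comment> \<open>The bound \<open>1\<close> keeps \<open>t\<close> its own representative
        modulo 1, and \<open>s + \<delta>\<close> keeps both curves inside
        \<open>X \<omega>\<close>.\<close>
      obtain t where t: "t \<in> \<rat>" "s < t" "t < min c (min 1 (s + \<delta>))"
        using Rats_dense_in_real[of s "min c (min 1 (s + \<delta>))"] c(1) s \<open>0 < \<delta>\<close> by auto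
      have "frac t = t" using t s by (simp add: frac_eq)
      then have "(t, f t) \<in> X \<omega>" "(t, f' t) \<in> X \<omega>"
        using f(3)[of t] f'(3)[of t] t \<open>0 < \<delta>\<close> by auto
      moreover have "t \<in> {0..<1} \<inter> \<rat>" using t s by auto
      ultimately have "f t = f' t \<or> \<epsilon> \<le> dist (f t) (f' t)" using elim(1) by blast
      then show False using c(2)[of t] t by auto
    qed
  qed
qed

end

section \<open>The cocycle at multiples of the return time\<close>

lemma cocycle_zero:
  assumes "perfect_C1_cocycle P \<theta> \<gamma>" "\<omega> \<in> space P" "s \<in> {0..<1}"
  shows "\<gamma> \<omega> 0 (s, y) = (s, y)"
proof -
  have "\<gamma> \<omega> 0 (s, y) = (frac s, y)" using assms(1,2) unfolding perfect_C1_cocycle_def by blast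
  then show ?thesis using assms(3) by (simp add: frac_eq)
qed

lemma cocycle_add:
  assumes "perfect_C1_cocycle P \<theta> \<gamma>" "\<omega> \<in> space P"
  shows "\<gamma> (\<theta> t \<omega>) u (\<gamma> \<omega> t z) = \<gamma> \<omega> (t + u) z"
  using assms unfolding perfect_C1_cocycle_def by (elim conjE) metis

text \<open>The range of \<open>s\<close> matters at \<open>n = 0\<close>, where
  \<open>Hiter\<close> is the identity but the cocycle reduces the first coordinate modulo
  1.\<close>

lemma Hiter_eq_cocycle:
  assumes mds: "metric_dynamical_system P \<theta>" and coc: "perfect_C1_cocycle P \<theta> \<gamma>"
    and \<omega>: "\<omega> \<in> space P" and s: "s \<in> {0..<1}"
  shows "Hiter \<gamma> \<theta> t1 n \<omega> (s, y) = \<gamma> \<omega> (real n * t1) (s, y)"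
proof (induction n)
  case 0
  show ?case using cocycle_zero[OF coc \<omega> s] by simp
next
  case (Suc n)
  have "(\<theta> t1 ^^ n) \<omega> = \<theta> (real n * t1) \<omega>"
  proof (induction n)
    case 0
    show ?case using mds_zero[OF mds \<omega>] by simp
  next
    case (Suc n)
    then show ?case using mds_add[OF mds \<omega>, of t1 "real n * t1"] by (simp add: algebra_simps)
  qed
  then show ?case
    using Suc cocycle_add[OF coc \<omega>, of "real n * t1" t1] by (simp add: algebra_simps)
qed

text \<open>The lift gains exactly \<open>1\<close> over each time \<open>t1\<close>, which is
  invisible modulo 1.\<close>

lemma fst_cocycle_period:
  assumes mds: "metric_dynamical_system P \<theta>" and coc: "perfect_C1_cocycle P \<theta> \<gamma>"
    and i: "condition_i P \<theta> \<gamma> t1 Y X bstar"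
    and \<omega>: "\<omega> \<in> space P" and sy: "(s, y) \<in> X \<omega>"
  shows "fst (\<gamma> \<omega> (real n * t1) (s, y)) = s"
proof (induction n)
  case 0
  have "s \<in> {0..<1}" using i \<omega> sy unfolding condition_i_def by blast
  then show ?case using cocycle_zero[OF coc \<omega>] by simp
next
  case (Suc n)
  define v where "v = \<theta> (real n * t1) \<omega>"
  have v: "v \<in> space P" using mds_space[OF mds \<omega>] by (simp add: v_def)
  define y' where "y' = snd (\<gamma> \<omega> (real n * t1) (s, y))"
  have z: "\<gamma> \<omega> (real n * t1) (s, y) = (s, y')" using Suc by (simp add: y'_def prod_eq_iff)
  \<comment> \<open>Invariance of \<open>X\<close> places the point in \<open>X v\<close>, hence its
    second coordinate in \<open>Y v\<close>, so the lift hypothesis applies to the next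
    turn.\<close>
  have "(s, y') \<in> X v"
    using i \<omega> sy z unfolding condition_i_def v_def by (metis imageI)
  then have s: "s \<in> {0..<1}" and y': "y' \<in> Y v"
    using i v unfolding condition_i_def by blast+
  have "\<forall>\<omega>\<in>space P. \<forall>s\<in>{0..<1}. \<forall>y\<in>Y \<omega>.
        (\<exists>lft. continuous_on {0..t1} lft \<and> (\<forall>t\<in>{0..t1}. frac (lft t) = fst (\<gamma> \<omega> t (s, y))) \<and>
          lft t1 = lft 0 + 1) \<and> snd (\<gamma> \<omega> t1 (s, y)) \<in> Y (\<theta> t1 \<omega>)"
    using i unfolding condition_i_def by (elim conjE)
  from this[rule_format, OF v s y', THEN conjunct1]
  obtain lft where lft: "\<And>t. t \<in> {0..t1} \<Longrightarrow> frac (lft t) = fst (\<gamma> v t (s, y'))" "lft t1 = lft 0 + 1"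
    by blast
  have "0 < t1" using i by (simp add: condition_i_def)
  then have "fst (\<gamma> v t1 (s, y')) = fst (\<gamma> v 0 (s, y'))"
    using lft(1)[of t1] lft(1)[of 0] lft(2) by (simp add: frac_def)
  also have "\<dots> = s" using cocycle_zero[OF coc v s] by simp
  finally have "fst (\<gamma> v t1 (s, y')) = s" .
  moreover have "\<gamma> v t1 (s, y') = \<gamma> \<omega> (real (Suc n) * t1) (s, y)"
    using cocycle_add[OF coc \<omega>, of "real n * t1" t1 "(s, y)"]
    unfolding v_def z by (simp add: algebra_simps)
  ultimately show ?case by simp
qed

section \<open>Contraction of the cocycle on fibres and the resulting curves\<close>

theorem theorem3p8:
  fixes P :: "'w measure" and \<theta> :: "real \<Rightarrow> 'w \<Rightarrow> 'w"
    and \<gamma> :: "'w \<Rightarrow> real \<Rightarrow> real \<times> 'd::euclidean_space \<Rightarrow> real \<times> 'd"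
    and Y :: "'w \<Rightarrow> 'd set" and X :: "'w \<Rightarrow> (real \<times> 'd) set"
    and t1 bstar :: real
  assumes mds: "metric_dynamical_system P \<theta>"
    and coc: "perfect_C1_cocycle P \<theta> \<gamma>"
    and cond_i: "condition_i P \<theta> \<gamma> t1 Y X bstar"
    and cond_ii: "condition_ii P X"
    and cond_iii: "condition_iii P \<theta> \<gamma> t1 X"
  shows "AE \<omega> in P. \<exists>(r::nat) (\<phi>::nat \<Rightarrow> real \<Rightarrow> 'd) (\<tau>::nat \<Rightarrow> nat).
           (\<forall>i\<in>{1..r}. \<tau> i > 0 \<and> (\<exists>L. L-lipschitz_on UNIV (\<phi> i)) \<and>
                         (\<forall>s. \<phi> i (s + real (\<tau> i)) = \<phi> i s)) \<and>
           X \<omega> = (\<Union>i\<in>{1..r}. periodic_curve (\<phi> i) (\<tau> i)) \<and>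
           inj_on (\<lambda>i. periodic_curve (\<phi> i) (\<tau> i)) {1..r}"
proof -
  obtain \<delta> L where \<delta>: "0 < \<delta>"
    and curves: "\<forall>\<omega>\<in>space P. \<forall>s y. (s, y) \<in> X \<omega> \<longrightarrow>
      (\<exists>f :: real \<Rightarrow> 'd. L-lipschitz_on UNIV f \<and> (\<forall>x. f (x + 1) = f x) \<and> f s = y \<and>
        (\<forall>s'\<in>{s - \<delta>..s + \<delta>}. (frac s', f s') \<in> X \<omega>))"
    using cond_ii unfolding condition_ii_def by (elim exE conjE) (rule that)
  note local_curve = curves[rule_format]
  obtain lam0 \<epsilon> n0 where lam0: "lam0 < 1" and eps: "0 < \<epsilon>"
    and deriv: "AE \<omega> in P. \<forall>s y. (s, y) \<in> Bnbhd (X \<omega>) \<epsilon> \<longrightarrow>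
      (\<exists>D. ((\<lambda>y'. giter \<gamma> \<theta> t1 n0 \<omega> (s, y')) has_derivative D) (at y) \<and> onorm D \<le> lam0)"
    using cond_iii unfolding condition_iii_def by (elim exE conjE) (rule that)
  \<comment> \<open>The rate is raised to at least \<open>1/2\<close> to make it positive while
    keeping it below \<open>1\<close>.\<close>
  define lam where "lam = max lam0 (1/2)"
  define p where "p = real n0 * t1"
  define g where "g \<omega> s y = snd (\<gamma> \<omega> p (s, y))" for \<omega> s y
  have X_circ: "fst ` X \<omega> = {0..<1}" and X_inv: "\<gamma> \<omega> t ` X \<omega> = X (\<theta> t \<omega>)"
    and X_diam: "(s, y) \<in> X \<omega> \<Longrightarrow> (s, y') \<in> X \<omega> \<Longrightarrow> norm (y - y') < bstar"
    if "\<omega> \<in> space P" for \<omega> t s y y'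
    using cond_i that unfolding condition_i_def by blast+
  have s_range: "s \<in> {0..<1}" if "\<omega> \<in> space P" "(s, y) \<in> X \<omega>" for \<omega> s y
    using X_circ[OF that(1)] that(2) by force
  have \<gamma>_g: "\<gamma> \<omega> p (s, y) = (s, g \<omega> s y)" if "\<omega> \<in> space P" "(s, y) \<in> X \<omega>" for \<omega> s y
    using fst_cocycle_period[OF mds coc cond_i that, of n0] by (simp add: g_def p_def prod_eq_iff)
  interpret fibre_contraction P \<theta> X g p bstar lam \<epsilon>
  proof
    show "random_compact_set_circ P X" using cond_i by (simp add: condition_i_def)
    show "X \<omega> \<noteq> {}" if "\<omega> \<in> space P" for \<omega> using X_circ[OF that] by auto
    show "dist y y' \<le> bstar" if "\<omega> \<in> space P" "(s, y) \<in> X \<omega>" "(s, y') \<in> X \<omega>" for \<omega> s y y'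
      using X_diam[OF that] by (simp add: dist_norm)
    show "g \<omega> s ` (X \<omega> `` {s}) = X (\<theta> p \<omega>) `` {s}" if "\<omega> \<in> space P" for \<omega> s
    proof
      show "g \<omega> s ` (X \<omega> `` {s}) \<subseteq> X (\<theta> p \<omega>) `` {s}"
        using \<gamma>_g[OF that] unfolding X_inv[OF that, symmetric] by (auto intro: rev_image_eqI)
      show "X (\<theta> p \<omega>) `` {s} \<subseteq> g \<omega> s ` (X \<omega> `` {s})"
        using \<gamma>_g[OF that] unfolding X_inv[OF that, symmetric] by force
    qed
    show "inj_on (g \<omega> s) (X \<omega> `` {s})" if "\<omega> \<in> space P" for \<omega> s
    proof (rule inj_onI)
      fix y y' assume y: "y \<in> X \<omega> `` {s}" "y' \<in> X \<omega> `` {s}" "g \<omega> s y = g \<omega> s y'"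
      \<comment> \<open>Time \<open>- p\<close> over the shifted \<omega> undoes time
        \<open>p\<close>, so equal images come from equal points.\<close>
      have "\<gamma> (\<theta> p \<omega>) (- p) (\<gamma> \<omega> p (s, u)) = (s, u)" if u: "(s, u) \<in> X \<omega>" for u
        using cocycle_add[OF coc \<open>\<omega> \<in> space P\<close>, of p "- p"]
          cocycle_zero[OF coc \<open>\<omega> \<in> space P\<close> s_range[OF \<open>\<omega> \<in> space P\<close> u]] by simp
      then show "y = y'" using \<gamma>_g[OF that] y by (metis Image_singleton_iff prod.inject)
    qed
    show "AE \<omega> in P. \<forall>s y y'. (s, y) \<in> X \<omega> \<longrightarrow> (s, y') \<in> X \<omega> \<longrightarrow> dist y y' \<le> \<epsilon> \<longrightarrow>
        dist (g \<omega> s y) (g \<omega> s y') \<le> lam * dist y y'"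
      using deriv AE_space
    proof eventually_elim
      case (elim \<omega>)
      show ?case
      proof (intro allI impI)
        fix s y y' assume y: "(s, y) \<in> X \<omega>" "(s, y') \<in> X \<omega>" "dist y y' \<le> \<epsilon>"
        have "giter \<gamma> \<theta> t1 n0 \<omega> (s, u) = g \<omega> s u" for u
          using Hiter_eq_cocycle[OF mds coc elim(2) s_range[OF elim(2) y(1)]]
          by (simp add: giter_def g_def p_def)
        \<comment> \<open>The derivative bound holds on a whole ball in the fibre around
          \<open>y\<close>. This ball is convex and contains \<open>y'\<close>, so the mean value
          inequality turns the bound into contraction of the pair.\<close>
        moreover have "(s, u) \<in> Bnbhd (X \<omega>) \<epsilon>" if "u \<in> cball y \<epsilon>" for u
          using that y(1) by (auto simp: Bnbhd_def dist_norm norm_minus_commute)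
        ultimately have "\<exists>D. (g \<omega> s has_derivative D) (at u) \<and> onorm D \<le> lam0"
          if "u \<in> cball y \<epsilon>" for u
          using elim(1)[rule_format, of s u] that by simp
        then obtain D where D: "\<And>u. u \<in> cball y \<epsilon> \<Longrightarrow> (g \<omega> s has_derivative D u) (at u) \<and> onorm (D u) \<le> lam0"
          by metis
        have "norm (g \<omega> s y - g \<omega> s y') \<le> lam * norm (y - y')"
        proof (rule differentiable_bound[of "cball y \<epsilon>" _ D])
          show "(g \<omega> s has_derivative D u) (at u within cball y \<epsilon>)" if "u \<in> cball y \<epsilon>" for u
            using D[OF that] has_derivative_at_withinI by blast
          show "onorm (D u) \<le> lam" if "u \<in> cball y \<epsilon>" for u
            using D[OF that] by (simp add: lam_def le_max_iff_disj)
        qed (use y eps in auto)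
        then show "dist (g \<omega> s y) (g \<omega> s y') \<le> lam * dist y y'" by (simp add: dist_norm)
      qed
    qed
    show "metric_dynamical_system P \<theta>" by (rule mds)
  qed (use lam0 eps in \<open>auto simp: lam_def\<close>)
  have "AE \<omega> in P. \<forall>s y y'. (s, y) \<in> X \<omega> \<longrightarrow> (s, y') \<in> X \<omega> \<longrightarrow> y \<noteq> y' \<longrightarrow> \<epsilon> \<le> dist y y'"
  proof (rule AE_fibres_separated[OF \<delta>])
    fix \<omega> s y assume "\<omega> \<in> space P" "(s, y) \<in> X \<omega>"
    from local_curve[OF this]
    show "\<exists>f. continuous_on UNIV f \<and> f s = y \<and> (\<forall>s'\<in>{s - \<delta>..s + \<delta>}. (frac s', f s') \<in> X \<omega>)"
      using lipschitz_on_continuous_on by fast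
  qed
  then show ?thesis using AE_finite_fibres AE_space
  proof eventually_elim
    case (elim \<omega>)
    show ?case
    proof (rule finite_union_of_periodic_curves[where \<delta> = \<delta> and \<epsilon> = \<epsilon> and L = L])
      fix s y assume "(frac s, y) \<in> X \<omega>"
      then obtain f where f: "L-lipschitz_on UNIV f" "\<And>x. f (x + 1) = f x" "f (frac s) = y"
          "\<And>s'. s' \<in> {frac s - \<delta>..frac s + \<delta>} \<Longrightarrow> (frac s', f s') \<in> X \<omega>"
        using local_curve[OF elim(3)] by blast
      \<comment> \<open>Continuation runs over the real line, while the given curve is centred at
        the representative \<open>frac s\<close>. Period \<open>1\<close> of \<open>f\<close> moves
        it to a curve centred at \<open>s\<close>.\<close>
      interpret periodic_fun_simple' f by standard (rule f(2))
      have shift: "f (x - \<lfloor>s\<rfloor>) = f x" for x :: real by (rule minus_of_int)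
      have "(frac s', f s') \<in> X \<omega>" if "s' \<in> {s - \<delta>..s + \<delta>}" for s'
      proof -
        have "s' - \<lfloor>s\<rfloor> \<in> {frac s - \<delta>..frac s + \<delta>}" using that by (auto simp: frac_def)
        then have "(frac (s' - \<lfloor>s\<rfloor>), f (s' - \<lfloor>s\<rfloor>)) \<in> X \<omega>" by (rule f(4))
        then show ?thesis using shift by (simp add: frac_def)
      qed
      moreover have "f s = y" using shift[of s] f(3) by (simp add: frac_def)
      moreover have "L-lipschitz_on {s - \<delta>..s + \<delta>} f" using f(1) lipschitz_on_subset by blast
      ultimately show "\<exists>f. L-lipschitz_on {s - \<delta>..s + \<delta>} f \<and> f s = y \<and>
          (\<forall>s'\<in>{s - \<delta>..s + \<delta>}. (frac s', f s') \<in> X \<omega>)" by blast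
    qed (use elim \<delta> eps X_circ in auto)
  qed
qed

end
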